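(* Let $1\le p<\infty$. The inclusions $$\ell_p^{\lambda}(\widehat F)\subset c_0^{\lambda}(\widehat F)\subset c^{\lambda}(\widehat F)\subset \ell_\infty^{\lambda}(\widehat F)$$ hold, and each of them is strict.
   Context: $\mathbb N_0=\{0,1,2,\dots\}$; $\omega$ is the space of all real sequences $x=(x_k)_{k\in\mathbb N_0}$; $c_0$, $c$, $\ell_\infty$ are the spaces of null, convergent and bounded real sequences. Fibonacci numbers: $f_0=f_1=1$, $f_n=f_{n-1}+f_{n-2}$ for $n\ge 2$. $\lambda=(\lambda_k)_{k\in\mathbb N_0}$ is a fixed strictly increasing sequence of positive reals with $\lambda_k\to\infty$. Terms with negative subscript are $0$ (so $\lambda_{-1}=0$, $x_{-1}=0$). For $x\in\omega$ put $$E_n(x)=\frac1{\lambda_n}\sum_{k=0}^n(\lambda_k-\lambda_{k-1})\Big(\frac{f_k}{f_{k+1}}x_k-\frac{f_{k+1}}{f_k}x_{k-1}\Big),\qquad Ex=(E_n(x))_{n\in\mathbb N_0}.$$ For $X\in\{\ell_p,c_0,c,\ell_\infty\}$ the corresponding space $\ell_p^{\lambda}(\widehat F)$, $c_0^{\lambda}(\widehat F)$, $c^{\lambda}(\widehat F)$, $\ell_\infty^{\lambda}(\widehat F)$ is $\{x\in\omega: Ex\in X\}$. *)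

theory Defs
  imports "HOL-Analysis.Analysis" "HOL-Number_Theory.Fib"
begin

text \<open>The library has \<open>fib 0 = 0\<close>, \<open>fib 1 = 1\<close>; here the sequence starts with \<open>f\<^sub>0 = f\<^sub>1 = 1\<close>.\<close>
definition fibo :: "nat \<Rightarrow> real" where
  "fibo n = real (fib (Suc n))"

text \<open>\<open>prev x k\<close> is \<open>x\<^bsub>k-1\<^esub>\<close>, where terms with negative subscript are \<open>0\<close>.\<close>
definition prev :: "(nat \<Rightarrow> real) \<Rightarrow> nat \<Rightarrow> real" where
  "prev x k = (if k = 0 then 0 else x (k - 1))"

definition E :: "(nat \<Rightarrow> real) \<Rightarrow> (nat \<Rightarrow> real) \<Rightarrow> nat \<Rightarrow> real" where
  "E lam x n = 1 / lam n *
     (\<Sum>k\<le>n. (lam k - prev lam k) *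
        (fibo k / fibo (Suc k) * x k - fibo (Suc k) / fibo k * prev x k))"

definition seq_lp :: "real \<Rightarrow> (nat \<Rightarrow> real) set" where
  "seq_lp p = {x. summable (\<lambda>k. \<bar>x k\<bar> powr p)}"

definition seq_c0 :: "(nat \<Rightarrow> real) set" where
  "seq_c0 = {x. x \<longlonglongrightarrow> 0}"

definition seq_c :: "(nat \<Rightarrow> real) set" where
  "seq_c = {x. convergent x}"

definition seq_linf :: "(nat \<Rightarrow> real) set" where
  "seq_linf = {x. bounded (range x)}"

definition E_domain :: "(nat \<Rightarrow> real) \<Rightarrow> (nat \<Rightarrow> real) set \<Rightarrow> (nat \<Rightarrow> real) set" where
  "E_domain lam X = {x. E lam x \<in> X}"

end

theory Submission
  imports Defs
begin

text \<open>The map \<open>x \<mapsto> E x\<close> is a composition of two triangular maps with nonzero diagonal entries,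
  hence surjective on the space of all sequences. Every inclusion between the
  \<open>E\<close>-domains is therefore strict exactly when the inclusion of the underlying classical
  sequence spaces is; the latter are separated by \<open>(k + 1)\<close> to the power \<open>- 1 / p\<close>, by the
  constant sequence \<open>1\<close> and by \<open>(-1)\<close> to the power \<open>k\<close>.\<close>

lemma sum_diff_prev: "(\<Sum>k\<le>n. w k - prev w k) = w n"
  by (induction n) (simp_all add: prev_def)

lemma fibo_pos: "0 < fibo n"
  by (simp add: fibo_def fib_neq_0_nat)

text \<open>Forward substitution: each clause is the equation \<open>fibo k / fibo (Suc k) * x k -
  fibo (Suc k) / fibo k * prev x k = z k\<close> solved for \<open>x k\<close>; at index 0 the
  \<open>prev\<close> term vanishes.\<close>

primrec fibo_diff_inv :: "(nat \<Rightarrow> real) \<Rightarrow> nat \<Rightarrow> real" where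
  "fibo_diff_inv z 0 = fibo 1 / fibo 0 * z 0"
| "fibo_diff_inv z (Suc k) = fibo (Suc (Suc k)) / fibo (Suc k) *
     (z (Suc k) + fibo (Suc (Suc k)) / fibo (Suc k) * fibo_diff_inv z k)"

lemma fibo_diff_inv:
  "fibo k / fibo (Suc k) * fibo_diff_inv z k - fibo (Suc k) / fibo k * prev (fibo_diff_inv z) k = z k"
proof -
  have nz: "fibo n \<noteq> 0" for n
    using fibo_pos[of n] by simp
  have "fibo k / fibo (Suc k) * (fibo (Suc k) / fibo k * u) = u" for k u
    using nz by simp
  then show ?thesis
    by (cases k) (simp_all only: prev_def fibo_diff_inv.simps One_nat_def, simp_all)
qed

lemma surj_E:
  assumes pos: "\<And>k. 0 < lam k" and mono: "strict_mono lam"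
  shows "surj (E lam)"
unfolding surj_def
proof
  fix y
  \<comment> \<open>The weighted sum in \<open>E\<close> has to equal \<open>w n\<close>. Taking
    increments of \<open>w\<close> divided by the weights as the inner terms makes that sum
    telescope.\<close>
  define w where "w k = lam k * y k" for k
  define z where "z k = (w k - prev w k) / (lam k - prev lam k)" for k
  \<comment> \<open>At index 0 the weight is \<open>lam 0\<close> itself, so positivity is used
    there and strict monotonicity at later indices.\<close>
  have "lam k - prev lam k \<noteq> 0" for k
    using pos[of k] strict_monoD[OF mono, of "k - 1" k] by (cases k) (auto simp: prev_def)
  then have "(lam k - prev lam k) * z k = w k - prev w k" for k
    by (simp add: z_def)
  then have "E lam (fibo_diff_inv z) n = 1 / lam n * w n" for n
    unfolding E_def fibo_diff_inv by (simp only: sum_diff_prev)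
  then have "E lam (fibo_diff_inv z) n = y n" for n
    using pos[of n] by (simp add: w_def)
  then have "E lam (fibo_diff_inv z) = y"
    by blast
  then show "\<exists>x. y = E lam x"
    by blast
qed

text \<open>Domains are preimages under \<open>E lam\<close>, so by surjectivity a point of
  \<open>Y\<close> outside \<open>X\<close> has a preimage that separates them.\<close>

lemma E_domain_psubset:
  assumes "surj (E lam)" "X \<subset> Y"
  shows "E_domain lam X \<subset> E_domain lam Y"
proof -
  obtain y where "y \<in> Y" "y \<notin> X"
    using assms(2) by blast
  moreover obtain x where "E lam x = y"
    using assms(1) by (metis surj_def)
  ultimately show ?thesis
    using assms(2) by (auto simp: E_domain_def)
qed

lemma seq_lp_psubset_c0:
  assumes "0 < p"
  shows "seq_lp p \<subset> seq_c0"
proof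
  show "seq_lp p \<subseteq> seq_c0"
  proof
    fix x assume "x \<in> seq_lp p"
    then have "(\<lambda>k. \<bar>x k\<bar> powr p) \<longlonglongrightarrow> 0"
      by (simp add: seq_lp_def summable_LIMSEQ_zero)
    \<comment> \<open>Taking p-th roots, continuous at 0 on nonnegative reals, turns this into a
      limit for \<open>\<bar>x k\<bar>\<close>.\<close>
    then have "(\<lambda>k. (\<bar>x k\<bar> powr p) powr (1 / p)) \<longlonglongrightarrow> 0 powr (1 / p)"
      using assms by (intro tendsto_powr') auto
    then have "(\<lambda>k. \<bar>x k\<bar>) \<longlonglongrightarrow> 0"
      using assms by (simp add: powr_powr)
    then show "x \<in> seq_c0"
      by (simp add: seq_c0_def tendsto_rabs_zero_iff)
  qed
  \<comment> \<open>The exponent turns the p-th powers into the harmonic series.\<close>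
  define y where "y k = real (Suc k) powr (- (1 / p))" for k
  have "\<bar>y k\<bar> powr p = inverse (real (Suc k))" for k
    unfolding y_def abs_of_nonneg[OF powr_ge_zero] powr_powr
    using assms by (simp add: powr_minus del: of_nat_Suc)
  then have "y \<notin> seq_lp p"
    using not_summable_harmonic[where ?'a = real]
    by (simp add: seq_lp_def summable_Suc_iff[of "\<lambda>n. inverse (real n)"] del: of_nat_Suc)
  moreover have "filterlim (\<lambda>k. real (Suc k)) at_top sequentially"
    by (rule filterlim_compose[OF filterlim_real_sequentially filterlim_Suc])
  then have "y \<in> seq_c0"
    unfolding seq_c0_def y_def mem_Collect_eq using assms by (intro tendsto_neg_powr) auto
  ultimately show "seq_lp p \<noteq> seq_c0"
    by blast
qed

lemma seq_c0_psubset_c: "seq_c0 \<subset> seq_c"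
proof -
  have "(\<lambda>_. 1) \<in> seq_c - seq_c0"
    by (simp add: seq_c_def seq_c0_def convergent_const tendsto_const_iff)
  then show ?thesis
    by (auto simp: seq_c_def seq_c0_def convergent_def)
qed

lemma seq_c_psubset_linf: "seq_c \<subset> seq_linf"
proof
  show "seq_c \<subseteq> seq_linf"
    by (auto simp: seq_c_def seq_linf_def convergent_imp_bounded convergent_def)
  have "(\<lambda>k. (-1) ^ k) \<in> seq_linf"
    by (auto simp: seq_linf_def bounded_iff power_abs intro!: exI[of _ 1])
  moreover have "\<not> convergent (\<lambda>k. (-1::real) ^ k)"
  proof
    assume "convergent (\<lambda>k. (-1::real) ^ k)"
    then obtain l :: real where l: "(\<lambda>k. (-1) ^ k) \<longlonglongrightarrow> l"
      by (auto simp: convergent_def)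
    \<comment> \<open>Shifting the index flips the sign, so \<open>l = - l\<close>; but a limit 0 is
      impossible for terms of absolute value 1.\<close>
    then have "(\<lambda>k. (-1) ^ Suc k) \<longlonglongrightarrow> l"
      by (rule LIMSEQ_Suc)
    then have "(\<lambda>k. (-1) ^ k) \<longlonglongrightarrow> - l"
      by (simp add: tendsto_minus_cancel_left)
    with l have "l = 0"
      using LIMSEQ_unique[of "\<lambda>k. (-1) ^ k" l "- l"] by simp
    then have "(\<lambda>k. \<bar>(-1::real) ^ k\<bar>) \<longlonglongrightarrow> 0"
      using l by (simp only: tendsto_rabs_zero)
    then show False
      by (simp add: power_abs LIMSEQ_const_iff)
  qed
  ultimately show "seq_c \<noteq> seq_linf"
    by (auto simp: seq_c_def)
qed

theorem theorem2p7:
  fixes lam :: "nat \<Rightarrow> real" and p :: real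
  assumes lam_pos: "\<And>k. 0 < lam k"
    and lam_mono: "strict_mono lam"
    and lam_lim: "filterlim lam at_top sequentially"
    and p: "1 \<le> p"
  shows "E_domain lam (seq_lp p) \<subset> E_domain lam seq_c0
    \<and> E_domain lam seq_c0 \<subset> E_domain lam seq_c
    \<and> E_domain lam seq_c \<subset> E_domain lam seq_linf"
  using surj_E[OF lam_pos lam_mono] p
  by (simp add: E_domain_psubset seq_lp_psubset_c0 seq_c0_psubset_c seq_c_psubset_linf)

end
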